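(* Let $(M,K)$ be an $n$-dimensional $m$-th root Cartan space, $m\ge3$, with mean Berwald curvature $\mathbf E=(E^{ij})$ and angular metric $\mathbf h=(h^{ij})$. Suppose that $K$ has isotropic mean Berwald curvature, i.e. there is a scalar function $c=c(x)$ on $M$ such that $$E^{ij}=\frac{n+1}{2}\,c\,K^{-1}h^{ij}\qquad\text{on } T^*M\setminus\{0\}\ \text{ for all } i,j .$$ Then $K$ is a weakly Berwald metric, i.e. $E^{ij}=0$ for all $i,j$.
   Context: Let $M$ be an $n$-dimensional smooth manifold and $T^*M_0=T^*M\setminus\{0\}$. Local coordinates on $T^*M$ are written $(x,p)=(x_i,p_i)$; write $\partial^i=\partial/\partial x_i$ and $\dot\partial^i=\partial/\partial p_i$. Repeated indices are summed. All local quantities below are defined by their formulas in the charts of a fixed atlas of $M$, and identities between them are understood in these coordinates. A Cartan space $(M,K)$ is given by a positive function $K(x,p)$, smooth on $T^*M_0$, continuous on the zero section, positively $1$-homogeneous in $p$, such that $g^{ij}(x,p)=\frac12\dot\partial^i\dot\partial^jK^2$ is positive definite on $T^*M_0$. It is an $m$-th root Cartan space ($m\ge3$ an integer) if $$K(x,p)=\sqrt[m]{a^{i_1\dots i_m}(x)p_{i_1}\cdots p_{i_m}},$$ with (smooth) coefficients $a^{i_1\dots i_m}(x)$ depending only on $x$ and symmetric in all indices. Put $a^{ij}(x,p)=K^{-(m-2)}a^{iji_3\dots i_m}(x)p_{i_3}\cdots p_{i_m}$; the matrix $(a^{ij})$ is invertible. Generalized Christoffel symbols: $$\{i_1\dots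 i_m,j\}=\tfrac1{2(m-1)}\big(\partial^{i_1}a^{i_2\dots i_mj}+\partial^{i_2}a^{i_3\dots i_mi_1j}+\dots+\partial^{i_m}a^{i_1\dots i_{m-1}j}-\partial^ja^{i_1\dots i_m}\big),$$ and $\{00\dots0,h\}=\{i_1\dots i_m,h\}p_{i_1}\cdots p_{i_m}$. The spray coefficients $G_r(x,p)$ (geodesics: $\ddot x_i+2G_i(x,\dot x)=0$) are the unique solution of $a^{hr}G_r=\frac{1}{mK^{m-2}}\{00\dots0,h\}$. Put $G^{ijk}_r=\dot\partial^k\dot\partial^j\dot\partial^iG_r$ (the Berwald curvature). Mean Berwald curvature ($E$-curvature): $E^{ij}=\frac12G^{rij}_r$. Angular metric: $h^{ij}=K\,\dot\partial^i\dot\partial^jK$. *)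

theory Defs
  imports "HOL-Analysis.Analysis" "HOL-Library.Multiset"
begin

section \<open>Smooth manifolds\<close>

text \<open>Used only for open \<open>S\<close>, where \<open>frechet_derivative\<close> is the honest derivative.\<close>

fun Ck_on :: "nat \<Rightarrow> 'a::real_normed_vector set \<Rightarrow> ('a \<Rightarrow> 'b::real_normed_vector) \<Rightarrow> bool" where
  "Ck_on 0 S f \<longleftrightarrow> continuous_on S f"
| "Ck_on (Suc k) S f \<longleftrightarrow>
     (\<forall>x\<in>S. f differentiable (at x)) \<and> (\<forall>v. Ck_on k S (\<lambda>x. frechet_derivative f (at x) v))"

definition smooth_on :: "'a::real_normed_vector set \<Rightarrow> ('a \<Rightarrow> 'b::real_normed_vector) \<Rightarrow> bool" where
  "smooth_on S f \<longleftrightarrow> (\<forall>k. Ck_on k S f)"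

text \<open>A chart is its domain together with its coordinate map; the dimension of the manifold is
  \<open>CARD('n)\<close>. The values of the coordinate map off the domain are irrelevant.\<close>

type_synonym ('a, 'n) chart = "'a set \<times> ('a \<Rightarrow> (real, 'n) vec)"

definition chart_inv :: "('a, 'n::finite) chart \<Rightarrow> real^'n \<Rightarrow> 'a" where
  "chart_inv \<phi> = inv_into (fst \<phi>) (snd \<phi>)"

definition chart_image :: "('a, 'n::finite) chart \<Rightarrow> (real^'n) set" where
  "chart_image \<phi> = snd \<phi> ` fst \<phi>"

definition smooth_manifold :: "'a topology \<Rightarrow> ('a, 'n::finite) chart set \<Rightarrow> bool" where
  "smooth_manifold M A \<longleftrightarrow>
     Hausdorff_space M \<and> second_countable M \<and>
     (\<Union>\<phi>\<in>A. fst \<phi>) = topspace M \<and>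
     (\<forall>\<phi>\<in>A. openin M (fst \<phi>) \<and> open (chart_image \<phi>) \<and>
        homeomorphic_map (subtopology M (fst \<phi>)) (top_of_set (chart_image \<phi>)) (snd \<phi>)) \<and>
     (\<forall>\<phi>\<in>A. \<forall>\<psi>\<in>A. smooth_on (snd \<phi> ` (fst \<phi> \<inter> fst \<psi>)) (snd \<psi> \<circ> chart_inv \<phi>))"

section \<open>The cotangent bundle\<close>

text \<open>A covector at \<open>q\<close> is the family of its components in all charts of the atlas around \<open>q\<close>,
  subject to the transformation rule for covectors. Components in charts not containing \<open>q\<close> are
  set to \<open>0\<close>, so that distinct families are distinct covectors.\<close>

definition cotangent_space ::
    "('a, 'n::finite) chart set \<Rightarrow> 'a \<Rightarrow> (('a, 'n) chart \<Rightarrow> real^'n) set" where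
  "cotangent_space A q =
     {\<omega>. (\<forall>\<phi>. \<not> (\<phi> \<in> A \<and> q \<in> fst \<phi>) \<longrightarrow> \<omega> \<phi> = 0) \<and>
          (\<forall>\<phi>\<in>A. \<forall>\<psi>\<in>A. q \<in> fst \<phi> \<and> q \<in> fst \<psi> \<longrightarrow>
             (\<forall>v. \<omega> \<phi> \<bullet> v =
                  \<omega> \<psi> \<bullet> frechet_derivative (snd \<psi> \<circ> chart_inv \<phi>) (at (snd \<phi> q)) v))}"

definition cotangent_bundle ::
    "'a topology \<Rightarrow> ('a, 'n::finite) chart set \<Rightarrow> ('a \<times> (('a, 'n) chart \<Rightarrow> real^'n)) set" where
  "cotangent_bundle M A = Sigma (topspace M) (cotangent_space A)"

text \<open>The covector at \<open>q\<close> whose components in the chart \<open>\<phi>\<close> are \<open>p\<close>.\<close>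

definition covector_of ::
    "('a, 'n::finite) chart set \<Rightarrow> ('a, 'n) chart \<Rightarrow> 'a \<Rightarrow> real^'n \<Rightarrow> ('a, 'n) chart \<Rightarrow> real^'n" where
  "covector_of A \<phi> q p = (\<lambda>\<psi>.
     if \<psi> \<in> A \<and> q \<in> fst \<psi>
     then adjoint (frechet_derivative (snd \<phi> \<circ> chart_inv \<psi>) (at (snd \<psi> q))) p else 0)"

text \<open>The expression \<open>K(x,p)\<close> of a function on the cotangent bundle in the induced coordinates.\<close>

definition local_rep ::
    "('a, 'n::finite) chart set \<Rightarrow> ('a \<times> (('a, 'n) chart \<Rightarrow> real^'n) \<Rightarrow> real) \<Rightarrow> ('a, 'n) chart
      \<Rightarrow> real^'n \<Rightarrow> real^'n \<Rightarrow> real" where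
  "local_rep A K \<phi> x p = K (chart_inv \<phi> x, covector_of A \<phi> (chart_inv \<phi> x) p)"

section \<open>Cartan spaces\<close>

definition pd :: "'n::finite \<Rightarrow> (real^'n \<Rightarrow> real) \<Rightarrow> real^'n \<Rightarrow> real" where
  "pd i f u = deriv (\<lambda>t. f (u + t *\<^sub>R axis i 1)) 0"

definition fund_tensor ::
    "(real^'n::finite \<Rightarrow> real^'n \<Rightarrow> real) \<Rightarrow> real^'n \<Rightarrow> real^'n \<Rightarrow> 'n \<Rightarrow> 'n \<Rightarrow> real" where
  "fund_tensor F x p i j = 1/2 * pd i (pd j (\<lambda>p. (F x p)\<^sup>2)) p"

definition angular_metric ::
    "(real^'n::finite \<Rightarrow> real^'n \<Rightarrow> real) \<Rightarrow> real^'n \<Rightarrow> real^'n \<Rightarrow> 'n \<Rightarrow> 'n \<Rightarrow> real" where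
  "angular_metric F x p i j = F x p * pd i (pd j (F x)) p"

definition cartan_space ::
    "'a topology \<Rightarrow> ('a, 'n::finite) chart set \<Rightarrow> ('a \<times> (('a, 'n) chart \<Rightarrow> real^'n) \<Rightarrow> real) \<Rightarrow> bool"
  where
  "cartan_space M A K \<longleftrightarrow>
     (\<forall>(q, \<omega>) \<in> cotangent_bundle M A. \<omega> \<noteq> (\<lambda>_. 0) \<longrightarrow> K (q, \<omega>) > 0) \<and>
     (\<forall>(q, \<omega>) \<in> cotangent_bundle M A. \<forall>t>0. K (q, \<lambda>\<phi>. t *\<^sub>R \<omega> \<phi>) = t * K (q, \<omega>)) \<and>
     (\<forall>\<phi>\<in>A. smooth_on (chart_image \<phi> \<times> (UNIV - {0})) (\<lambda>(x, p). local_rep A K \<phi> x p) \<and>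
        continuous_on (chart_image \<phi> \<times> UNIV) (\<lambda>(x, p). local_rep A K \<phi> x p) \<and>
        (\<forall>x\<in>chart_image \<phi>. \<forall>p. p \<noteq> 0 \<longrightarrow>
           (\<forall>v. v \<noteq> 0 \<longrightarrow>
              (\<Sum>i\<in>UNIV. \<Sum>j\<in>UNIV. fund_tensor (local_rep A K \<phi>) x p i j * v $ i * v $ j) > 0)))"

section \<open>m-th root Cartan spaces\<close>

text \<open>A multi-index \<open>i\<^sub>1\<dots>i\<^sub>m\<close> is a list of length \<open>m\<close>; the coefficients in a chart are a function
  \<open>\<alpha>\<close> of \<open>x\<close> and a multi-index.\<close>

definition mono_at :: "real^'n::finite \<Rightarrow> 'n list \<Rightarrow> real" where
  "mono_at p I = prod_list (map (\<lambda>i. p $ i) I)"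

definition mth_root_cartan_space ::
    "'a topology \<Rightarrow> ('a, 'n::finite) chart set \<Rightarrow> ('a \<times> (('a, 'n) chart \<Rightarrow> real^'n) \<Rightarrow> real)
      \<Rightarrow> nat \<Rightarrow> (('a, 'n) chart \<Rightarrow> real^'n \<Rightarrow> 'n list \<Rightarrow> real) \<Rightarrow> bool" where
  "mth_root_cartan_space M A K m a \<longleftrightarrow>
     cartan_space M A K \<and>
     (\<forall>\<phi>\<in>A.
        (\<forall>I. length I = m \<longrightarrow> smooth_on (chart_image \<phi>) (\<lambda>x. a \<phi> x I)) \<and>
        (\<forall>x\<in>chart_image \<phi>. \<forall>I J. length I = m \<and> mset I = mset J \<longrightarrow> a \<phi> x I = a \<phi> x J) \<and>
        (\<forall>x\<in>chart_image \<phi>. \<forall>p.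
           local_rep A K \<phi> x p = root m (\<Sum>I | length I = m. a \<phi> x I * mono_at p I)))"

text \<open>In the following, \<open>F\<close> and \<open>\<alpha>\<close> are the expressions of \<open>K\<close> and of the coefficients in a chart.\<close>

definition a2 ::
    "nat \<Rightarrow> (real^'n::finite \<Rightarrow> real^'n \<Rightarrow> real) \<Rightarrow> (real^'n \<Rightarrow> 'n list \<Rightarrow> real)
      \<Rightarrow> real^'n \<Rightarrow> real^'n \<Rightarrow> 'n \<Rightarrow> 'n \<Rightarrow> real" where
  "a2 m F \<alpha> x p i j =
     inverse (F x p ^ (m - 2)) * (\<Sum>I | length I = m - 2. \<alpha> x (i # j # I) * mono_at p I)"

text \<open>The \<open>k\<close>-th summand differentiates along the \<open>k\<close>-th index of \<open>I\<close>; the remaining ones follow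
  in cyclic order, and \<open>j\<close> comes last.\<close>

definition gen_christoffel ::
    "nat \<Rightarrow> (real^'n::finite \<Rightarrow> 'n list \<Rightarrow> real) \<Rightarrow> real^'n \<Rightarrow> 'n list \<Rightarrow> 'n \<Rightarrow> real" where
  "gen_christoffel m \<alpha> x I j =
     1 / (2 * (real m - 1)) *
     ((\<Sum>k<m. pd (I ! k) (\<lambda>x. \<alpha> x (drop (Suc k) I @ take k I @ [j])) x) - pd j (\<lambda>x. \<alpha> x I) x)"

definition christoffel0 ::
    "nat \<Rightarrow> (real^'n::finite \<Rightarrow> 'n list \<Rightarrow> real) \<Rightarrow> real^'n \<Rightarrow> real^'n \<Rightarrow> 'n \<Rightarrow> real" where
  "christoffel0 m \<alpha> x p h = (\<Sum>I | length I = m. gen_christoffel m \<alpha> x I h * mono_at p I)"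

text \<open>For \<open>p \<noteq> 0\<close> the matrix \<open>a2\<close> is invertible, as \<open>fund_tensor\<close> is positive definite and equals
  \<open>m - 1\<close> times \<open>a2\<close> minus a positive semidefinite matrix of rank one; so the system below has
  exactly one solution.\<close>

definition spray ::
    "nat \<Rightarrow> (real^'n::finite \<Rightarrow> real^'n \<Rightarrow> real) \<Rightarrow> (real^'n \<Rightarrow> 'n list \<Rightarrow> real)
      \<Rightarrow> real^'n \<Rightarrow> real^'n \<Rightarrow> real^'n" where
  "spray m F \<alpha> x p =
     (THE G. \<forall>h. (\<Sum>r\<in>UNIV. a2 m F \<alpha> x p h r * G $ r) =
                  1 / (real m * F x p ^ (m - 2)) * christoffel0 m \<alpha> x p h)"

text \<open>\<open>berwald_curvature m F \<alpha> x p r i j k\<close> is $G^{ijk}_r$.\<close>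

definition berwald_curvature ::
    "nat \<Rightarrow> (real^'n::finite \<Rightarrow> real^'n \<Rightarrow> real) \<Rightarrow> (real^'n \<Rightarrow> 'n list \<Rightarrow> real)
      \<Rightarrow> real^'n \<Rightarrow> real^'n \<Rightarrow> 'n \<Rightarrow> 'n \<Rightarrow> 'n \<Rightarrow> 'n \<Rightarrow> real" where
  "berwald_curvature m F \<alpha> x p r i j k = pd k (pd j (pd i (\<lambda>p. spray m F \<alpha> x p $ r))) p"

definition mean_berwald ::
    "nat \<Rightarrow> (real^'n::finite \<Rightarrow> real^'n \<Rightarrow> real) \<Rightarrow> (real^'n \<Rightarrow> 'n list \<Rightarrow> real)
      \<Rightarrow> real^'n \<Rightarrow> real^'n \<Rightarrow> 'n \<Rightarrow> 'n \<Rightarrow> real" where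
  "mean_berwald m F \<alpha> x p i j = 1/2 * (\<Sum>r\<in>UNIV. berwald_curvature m F \<alpha> x p r r i j)"

definition isotropic_mean_berwald ::
    "('a, 'n::finite) chart set \<Rightarrow> ('a \<times> (('a, 'n) chart \<Rightarrow> real^'n) \<Rightarrow> real)
      \<Rightarrow> nat \<Rightarrow> (('a, 'n) chart \<Rightarrow> real^'n \<Rightarrow> 'n list \<Rightarrow> real) \<Rightarrow> bool" where
  "isotropic_mean_berwald A K m a \<longleftrightarrow>
     (\<exists>c :: 'a \<Rightarrow> real. \<forall>\<phi>\<in>A. \<forall>q\<in>fst \<phi>. \<forall>p. p \<noteq> 0 \<longrightarrow> (\<forall>i j.
        mean_berwald m (local_rep A K \<phi>) (a \<phi>) (snd \<phi> q) p i j =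
          (real CARD('n) + 1) / 2 * c q * inverse (local_rep A K \<phi> (snd \<phi> q) p) *
          angular_metric (local_rep A K \<phi>) (snd \<phi> q) p i j))"

definition weakly_berwald ::
    "('a, 'n::finite) chart set \<Rightarrow> ('a \<times> (('a, 'n) chart \<Rightarrow> real^'n) \<Rightarrow> real)
      \<Rightarrow> nat \<Rightarrow> (('a, 'n) chart \<Rightarrow> real^'n \<Rightarrow> 'n list \<Rightarrow> real) \<Rightarrow> bool" where
  "weakly_berwald A K m a \<longleftrightarrow>
     (\<forall>\<phi>\<in>A. \<forall>q\<in>fst \<phi>. \<forall>p. p \<noteq> 0 \<longrightarrow> (\<forall>i j.
        mean_berwald m (local_rep A K \<phi>) (a \<phi>) (snd \<phi> q) p i j = 0))"

end

theory Submission
  imports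
    Defs
    "HOL-Computational_Algebra.Polynomial_Factorial"
    "HOL-Computational_Algebra.Field_as_Ring"
begin

text \<open>Fix a chart and a point \<open>x\<close>. The linear system for the spray has coefficients polynomial in
  \<open>p\<close> after cancelling powers of \<open>K\<close>, so by Cramer's rule the spray coefficients, and with them the
  divergence \<open>S\<close> of the spray in \<open>p\<close>, are rational functions of \<open>p\<close>. Since \<open>2 E\<close> is the Hessian of
  \<open>S\<close>, isotropy says that \<open>S - (n + 1) c K\<close> is affine on every line avoiding the origin. If \<open>c \<noteq> 0\<close>,
  then \<open>K\<close> is rational on such a line; as \<open>K ^ (2 m)\<close> is a polynomial of degree at most \<open>2 m\<close> there,
  \<open>K\<close> is a polynomial of degree at most one without zeros, hence constant, against positive
  definiteness. For \<open>n = 1\<close> there is no such line, but then the angular metric vanishes by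
  homogeneity.\<close>

section \<open>Partial derivatives\<close>

text \<open>Chain rule along a coordinate line. It lets the calculus rules for \<open>pd\<close> be
  read off from those for Frechet derivatives.\<close>

lemma pd_eq_derivative:
  assumes "(f has_derivative D) (at x)"
  shows "pd i f x = D (axis i 1)"
proof -
  have "((\<lambda>t::real. x + t *\<^sub>R axis i 1) has_derivative (\<lambda>t. t *\<^sub>R axis i 1)) (at 0)"
    by (auto intro!: derivative_eq_intros)
  then have "((\<lambda>t. f (x + t *\<^sub>R axis i 1)) has_derivative (\<lambda>t. D (t *\<^sub>R axis i 1))) (at 0)"
    by (rule has_derivative_compose) (use assms in simp)
  moreover have "(\<lambda>t. D (t *\<^sub>R axis i 1)) = (*) (D (axis i 1))"
    using linear_cmul[OF has_derivative_linear[OF assms]] by (auto simp: fun_eq_iff)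
  ultimately have "((\<lambda>t. f (x + t *\<^sub>R axis i 1)) has_real_derivative D (axis i 1)) (at 0)"
    by (simp add: has_field_derivative_def)
  then show ?thesis
    unfolding pd_def by (rule DERIV_imp_deriv)
qed

lemma pd_const [simp]: "pd i (\<lambda>_. c) x = 0"
  by (simp add: pd_def)

lemma pd_add:
  assumes "f differentiable at x" "g differentiable at x"
  shows "pd i (\<lambda>y. f y + g y) x = pd i f x + pd i g x"
proof -
  obtain f' g' where "(f has_derivative f') (at x)" "(g has_derivative g') (at x)"
    using assms by (auto simp: differentiable_def)
  then show ?thesis
    using pd_eq_derivative[OF has_derivative_add] by (simp add: pd_eq_derivative)
qed

lemma pd_sum:
  assumes "finite S" "\<And>s. s \<in> S \<Longrightarrow> f s differentiable at x"
  shows "pd i (\<lambda>y. \<Sum>s\<in>S. f s y) x = (\<Sum>s\<in>S. pd i (f s) x)"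
  using assms
proof (induction S rule: finite_induct)
  case (insert s S)
  then show ?case
    by (simp add: pd_add)
qed simp

lemma pd_mult:
  assumes "f differentiable at x" "g differentiable at x"
  shows "pd i (\<lambda>y. f y * g y) x = pd i f x * g x + f x * pd i g x"
proof -
  obtain f' g' where "(f has_derivative f') (at x)" "(g has_derivative g') (at x)"
    using assms by (auto simp: differentiable_def)
  then show ?thesis
    using pd_eq_derivative[OF has_derivative_mult] by (simp add: pd_eq_derivative add.commute)
qed

lemma pd_divide:
  assumes "f differentiable at x" "g differentiable at x" "g x \<noteq> 0"
  shows "pd i (\<lambda>y. f y / g y) x = (pd i f x * g x - f x * pd i g x) / (g x * g x)"
proof -
  obtain f' g' where "(f has_derivative f') (at x)" "(g has_derivative g') (at x)"
    using assms by (auto simp: differentiable_def)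
  then show ?thesis
    using pd_eq_derivative[OF has_derivative_divide'] assms(3) by (simp add: pd_eq_derivative)
qed

lemma pd_cong:
  assumes "open V" "x \<in> V" "\<And>y. y \<in> V \<Longrightarrow> f y = g y"
  shows "pd i f x = pd i g x"
proof -
  have "((\<lambda>t::real. x + t *\<^sub>R axis i 1) \<longlongrightarrow> x + 0 *\<^sub>R axis i 1) (nhds 0)"
    by (intro tendsto_intros filterlim_ident)
  then have "eventually (\<lambda>t::real. x + t *\<^sub>R axis i 1 \<in> V) (nhds 0)"
    using assms by (auto dest!: topological_tendstoD)
  then show ?thesis
    unfolding pd_def by (intro deriv_cong_ev) (auto elim!: eventually_mono simp: assms)
qed

lemma differentiable_cong_open:
  assumes "open V" "x \<in> V" "\<And>y. y \<in> V \<Longrightarrow> f y = g y" "f differentiable at x"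
  shows "g differentiable at x"
  using assms has_derivative_transform_within_open unfolding differentiable_def by blast

section \<open>First and second derivatives along straight lines\<close>

lemma has_real_derivative_along_line:
  fixes f :: "real^'n::finite \<Rightarrow> real"
  assumes "f differentiable at (u + t *\<^sub>R v)"
  shows "((\<lambda>s. f (u + s *\<^sub>R v)) has_real_derivative (\<Sum>j\<in>UNIV. v $ j * pd j f (u + t *\<^sub>R v))) (at t)"
proof -
  obtain D where D: "(f has_derivative D) (at (u + t *\<^sub>R v))"
    using assms by (auto simp: differentiable_def)
  then have lin: "linear D"
    by (rule has_derivative_linear)
  have "((\<lambda>s. u + s *\<^sub>R v) has_derivative (\<lambda>s. s *\<^sub>R v)) (at t)"
    by (auto intro!: derivative_eq_intros)
  then have "((\<lambda>s. f (u + s *\<^sub>R v)) has_derivative (\<lambda>s. D (s *\<^sub>R v))) (at t)"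
    by (rule has_derivative_compose) (use D in simp)
  moreover have "(\<lambda>s. D (s *\<^sub>R v)) = (*) (D v)"
    using linear_cmul[OF lin] by (auto simp: fun_eq_iff)
  moreover have "D v = D (\<Sum>j\<in>UNIV. v $ j *\<^sub>R axis j 1)"
    using basis_expansion[of v] by (simp add: scalar_mult_eq_scaleR)
  then have "D v = (\<Sum>j\<in>UNIV. v $ j * pd j f (u + t *\<^sub>R v))"
    by (simp add: linear_sum[OF lin] linear_cmul[OF lin] pd_eq_derivative[OF D])
  ultimately show ?thesis
    by (simp add: has_field_derivative_def)
qed

lemma eventually_line_nonzero:
  fixes u v :: "'b::real_normed_vector"
  assumes "u \<noteq> 0"
  shows "eventually (\<lambda>s::real. u + s *\<^sub>R v \<noteq> 0) (nhds 0)"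
proof -
  have "((\<lambda>s::real. u + s *\<^sub>R v) \<longlongrightarrow> u + 0 *\<^sub>R v) (nhds 0)"
    by (intro tendsto_intros filterlim_ident)
  then show ?thesis
    using assms by (auto dest: tendsto_imp_eventually_ne)
qed

definition grad_form :: "(real^'n::finite \<Rightarrow> real) \<Rightarrow> real^'n \<Rightarrow> real^'n \<Rightarrow> real" where
  "grad_form f u v = (\<Sum>j\<in>UNIV. v $ j * pd j f u)"

definition hess_form :: "(real^'n::finite \<Rightarrow> real) \<Rightarrow> real^'n \<Rightarrow> real^'n \<Rightarrow> real" where
  "hess_form f u v = (\<Sum>j\<in>UNIV. v $ j * (\<Sum>i\<in>UNIV. v $ i * pd i (pd j f) u))"

text \<open>The regularity common to a Cartan function on a fibre, which is smooth only off the
  origin, and to rational functions without poles off the origin.\<close>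

definition twice_diff_off_zero :: "(real^'n::finite \<Rightarrow> real) \<Rightarrow> bool" where
  "twice_diff_off_zero f \<longleftrightarrow>
     (\<forall>u. u \<noteq> 0 \<longrightarrow> f differentiable at u \<and> (\<forall>j. pd j f differentiable at u))"

lemma line_derivatives:
  assumes "twice_diff_off_zero f" "u + t *\<^sub>R v \<noteq> 0"
  shows "((\<lambda>s. f (u + s *\<^sub>R v)) has_real_derivative grad_form f (u + t *\<^sub>R v) v) (at t)"
    and "((\<lambda>s. grad_form f (u + s *\<^sub>R v) v) has_real_derivative hess_form f (u + t *\<^sub>R v) v) (at t)"
  using assms unfolding twice_diff_off_zero_def grad_form_def hess_form_def
  by (auto intro!: has_real_derivative_along_line DERIV_sum DERIV_cmult)

text \<open>Serves to read off both forms when an explicit formula for \<open>f\<close> is known on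
  a short piece of a line: for \<open>F\<close>, linearity on rays and, at the end, constancy on a
  line.\<close>

lemma line_derivatives_unique:
  assumes "twice_diff_off_zero f" "u \<noteq> 0"
    and eq: "eventually (\<lambda>s. f (u + s *\<^sub>R v) = g s) (nhds 0)"
    and g: "eventually (\<lambda>s. (g has_real_derivative g' s) (at s)) (nhds 0)"
    and g': "(g' has_real_derivative g2) (at 0)"
  shows "grad_form f u v = g' 0" "hess_form f u v = g2"
proof -
  \<comment> \<open>Agreement near 0 is agreement near every \<open>s\<close> close to 0. So the
    first derivatives agree on a neighbourhood and can be differentiated again.\<close>
  have "eventually (\<lambda>s. eventually (\<lambda>s. f (u + s *\<^sub>R v) = g s) (nhds s)) (nhds 0)"
    using eq by (simp add: eventually_eventually)
  then have ev: "eventually (\<lambda>s. grad_form f (u + s *\<^sub>R v) v = g' s) (nhds 0)"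
    using g eventually_line_nonzero[OF assms(2), of v]
  proof eventually_elim
    case (elim s)
    have "((\<lambda>s. f (u + s *\<^sub>R v)) has_real_derivative g' s) (at s)"
      using elim by (subst DERIV_cong_ev[OF refl _ refl]) auto
    then show ?case
      using line_derivatives(1)[OF assms(1) elim(3)] DERIV_unique by blast
  qed
  then show "grad_form f u v = g' 0"
    using eventually_nhds_x_imp_x by force
  have "((\<lambda>s. grad_form f (u + s *\<^sub>R v) v) has_real_derivative g2) (at 0)"
    using ev g' by (subst DERIV_cong_ev[OF refl _ refl]) auto
  moreover have "((\<lambda>s. grad_form f (u + s *\<^sub>R v) v) has_real_derivative hess_form f u v) (at 0)"
    using line_derivatives(2)[OF assms(1), of u 0 v] assms(2) by simp
  ultimately show "hess_form f u v = g2"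
    using DERIV_unique by blast
qed

text \<open>The product rule for half the second derivative of the square of \<open>F\<close>.
  Positive definiteness becomes a statement about the first and second derivatives of
  \<open>F\<close> along lines.\<close>

lemma fund_tensor_form:
  assumes "twice_diff_off_zero (F x)" "p \<noteq> 0"
  shows "(\<Sum>i\<in>UNIV. \<Sum>j\<in>UNIV. fund_tensor F x p i j * v $ i * v $ j) =
    (grad_form (F x) p v)\<^sup>2 + F x p * hess_form (F x) p v"
proof -
  have d1: "F x differentiable at q" and d2: "pd j (F x) differentiable at q" if "q \<noteq> 0" for q j
    using assms(1) that by (auto simp: twice_diff_off_zero_def)
  have eq: "fund_tensor F x p i j = pd i (F x) p * pd j (F x) p + F x p * pd i (pd j (F x)) p" for i j
  proof -
    have "pd i (pd j (\<lambda>p. (F x p)\<^sup>2)) p = pd i (\<lambda>p. (2 * F x p) * pd j (F x) p) p"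
      using assms(2)
      by (intro pd_cong[where V = "- {0}"]) (auto simp: power2_eq_square pd_mult d1)
    also have "\<dots> = 2 * (pd i (F x) p * pd j (F x) p + F x p * pd i (pd j (F x)) p)"
      using assms(2) by (subst pd_mult) (auto simp: d1 d2 pd_mult algebra_simps)
    finally show ?thesis
      by (simp add: fund_tensor_def)
  qed
  have "(\<Sum>i\<in>UNIV. \<Sum>j\<in>UNIV. fund_tensor F x p i j * v $ i * v $ j) =
      (\<Sum>i\<in>UNIV. \<Sum>j\<in>UNIV. (v $ i * pd i (F x) p) * (v $ j * pd j (F x) p)) +
      F x p * (\<Sum>i\<in>UNIV. \<Sum>j\<in>UNIV. v $ j * (v $ i * pd i (pd j (F x)) p))"
    by (simp add: eq algebra_simps sum.distrib sum_distrib_left)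
  also have "(\<Sum>i\<in>UNIV. \<Sum>j\<in>UNIV. v $ j * (v $ i * pd i (pd j (F x)) p)) = hess_form (F x) p v"
    unfolding hess_form_def sum_distrib_left by (rule sum.swap)
  also have "(\<Sum>i\<in>UNIV. \<Sum>j\<in>UNIV. (v $ i * pd i (F x) p) * (v $ j * pd j (F x) p)) =
      (grad_form (F x) p v)\<^sup>2"
    by (simp add: grad_form_def power2_eq_square sum_product)
  finally show ?thesis .
qed

text \<open>A partial derivative in \<open>p\<close> is the joint derivative in the direction
  \<open>(0, axis j 1)\<close>, and a slice of a differentiable function is differentiable. Two
  levels of \<open>Ck_on\<close> therefore suffice.\<close>

lemma smooth_on_slice:
  fixes h :: "(real^'n::finite) \<times> (real^'n) \<Rightarrow> real"
  assumes U: "open U" "x \<in> U" and smooth: "smooth_on (U \<times> (UNIV - {0})) h"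
  shows "twice_diff_off_zero (\<lambda>p. h (x, p))"
proof -
  have "Ck_on (Suc (Suc 0)) (U \<times> (UNIV - {0})) h"
    using smooth by (simp only: smooth_on_def)
  then have d1: "h differentiable at z" 
    and d2: "(\<lambda>z. frechet_derivative h (at z) w) differentiable at z" if "z \<in> U \<times> (UNIV - {0})" for z w
    using that unfolding Ck_on.simps by blast+
  have slice: "(\<lambda>p. k (x, p)) differentiable at p" if "k differentiable at (x, p)" 
    for k :: "(real^'n) \<times> (real^'n) \<Rightarrow> real" and p
  proof -
    have "(k \<circ> Pair x) differentiable at p"
      using that by (intro differentiable_chain_at) (auto simp: differentiable_def intro!: derivative_eq_intros exI)
    then show ?thesis
      by (simp add: o_def)
  qed
  have pd: "pd j (\<lambda>p. h (x, p)) p = frechet_derivative h (at (x, p)) (0, axis j 1)" if "p \<noteq> 0" for j p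
  proof -
    have "(h has_derivative frechet_derivative h (at (x, p))) (at (x, p))"
      using d1[of "(x, p)"] U that by (simp add: frechet_derivative_works)
    then have "((\<lambda>p. h (x, p)) has_derivative (\<lambda>v. frechet_derivative h (at (x, p)) (0, v))) (at p)"
      by (rule has_derivative_compose[rotated]) (auto intro!: derivative_eq_intros)
    then show ?thesis
      by (rule pd_eq_derivative)
  qed
  have "pd j (\<lambda>p. h (x, p)) differentiable at p" if "p \<noteq> 0" for j p
    using that U
    by (intro differentiable_cong_open[OF _ _ pd[symmetric] slice[OF d2], where V = "- {0}"]) auto
  then show ?thesis
    using slice[OF d1] U by (auto simp: twice_diff_off_zero_def)
qed

section \<open>Rational functions\<close>

lemma differentiable_real_polynomial_function:
  "real_polynomial_function f \<Longrightarrow> f differentiable at x"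
  by (simp add: differentiable_at_polynomial_function real_polynomial_function_eq)

lemma real_polynomial_function_pd:
  assumes "real_polynomial_function f"
  shows "real_polynomial_function (pd i f)"
  using assms
proof (induction rule: real_polynomial_function.induct)
  case (linear f)
  then have "pd i f = (\<lambda>_. f (axis i 1))"
    using pd_eq_derivative[OF bounded_linear_imp_has_derivative] by auto
  then show ?case
    by (simp add: real_polynomial_function.intros(2))
next
  case (const c)
  have "pd i (\<lambda>_. c) = (\<lambda>_. 0)"
    by auto
  then show ?case
    by (simp add: real_polynomial_function.intros(2))
next
  case (add f g)
  then have "pd i (\<lambda>x. f x + g x) = (\<lambda>x. pd i f x + pd i g x)"
    by (auto simp: pd_add differentiable_real_polynomial_function)
  then show ?case
    using add by (simp add: real_polynomial_function.intros(3))
next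
  case (mult f g)
  then have "pd i (\<lambda>x. f x * g x) = (\<lambda>x. pd i f x * g x + f x * pd i g x)"
    by (auto simp: pd_mult differentiable_real_polynomial_function)
  then show ?case
    using mult by (simp add: real_polynomial_function.intros(3) real_polynomial_function.intros(4))
qed

text \<open>One fraction serves for all nonzero \<open>p\<close>, so on a line missing the origin
  the denominator becomes a polynomial without real zeros.\<close>

definition rational_off_zero :: "(real^'n::finite \<Rightarrow> real) \<Rightarrow> bool" where
  "rational_off_zero f \<longleftrightarrow> (\<exists>N D. real_polynomial_function N \<and> real_polynomial_function D \<and>
     (\<forall>p. p \<noteq> 0 \<longrightarrow> D p \<noteq> 0 \<and> f p = N p / D p))"

lemma rational_off_zero_add:
  assumes "rational_off_zero f" "rational_off_zero g"
  shows "rational_off_zero (\<lambda>p. f p + g p)"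
proof -
  obtain N D N' D' where *: "real_polynomial_function N" "real_polynomial_function D"
      "real_polynomial_function N'" "real_polynomial_function D'"
      "\<And>p. p \<noteq> 0 \<Longrightarrow> D p \<noteq> 0 \<and> f p = N p / D p" "\<And>p. p \<noteq> 0 \<Longrightarrow> D' p \<noteq> 0 \<and> g p = N' p / D' p"
    using assms unfolding rational_off_zero_def by metis
  then show ?thesis
    unfolding rational_off_zero_def
    by (intro exI[of _ "\<lambda>p. N p * D' p + N' p * D p"] exI[of _ "\<lambda>p. D p * D' p"])
      (auto simp: add_frac_eq)
qed

lemma rational_off_zero_sum:
  assumes "finite S" "\<And>s. s \<in> S \<Longrightarrow> rational_off_zero (f s)"
  shows "rational_off_zero (\<lambda>p. \<Sum>s\<in>S. f s p)"
  using assms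
proof (induction S rule: finite_induct)
  case empty
  show ?case
    unfolding rational_off_zero_def
    by (rule exI[of _ "\<lambda>_. 0"], rule exI[of _ "\<lambda>_. 1"])
      (simp add: real_polynomial_function.intros(2))
next
  case (insert s S)
  then show ?case
    by (simp add: rational_off_zero_add)
qed

text \<open>By the quotient rule the new denominator is \<open>D p * D p\<close>, which again has no
  zeros off the origin.\<close>

lemma rational_off_zero_imp:
  assumes "rational_off_zero f"
  shows rational_off_zero_differentiable: "p \<noteq> 0 \<Longrightarrow> f differentiable at p"
    and rational_off_zero_pd: "rational_off_zero (pd i f)"
proof -
  obtain N D where *: "real_polynomial_function N" "real_polynomial_function D"
      and eq: "\<And>p. p \<noteq> 0 \<Longrightarrow> D p \<noteq> 0 \<and> f p = N p / D p"
    using assms unfolding rational_off_zero_def by metis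
  show "f differentiable at p" if "p \<noteq> 0" for p
  proof (rule differentiable_cong_open[where V = "- {0}"])
    show "(\<lambda>p. N p / D p) differentiable at p"
      using that eq by (simp add: differentiable_divide differentiable_real_polynomial_function *)
  qed (use that eq in auto)
  have "pd i f p = (pd i N p * D p - N p * pd i D p) / (D p * D p)" if "p \<noteq> 0" for p
  proof -
    have "pd i f p = pd i (\<lambda>p. N p / D p) p"
      by (rule pd_cong[where V = "- {0}"]) (use that eq in auto)
    then show ?thesis
      using that eq by (simp add: pd_divide differentiable_real_polynomial_function *)
  qed
  then show "rational_off_zero (pd i f)"
    unfolding rational_off_zero_def using eq
    by (intro exI[of _ "\<lambda>p. pd i N p * D p - N p * pd i D p"] exI[of _ "\<lambda>p. D p * D p"])
      (auto intro!: real_polynomial_function.intros(4) real_polynomial_function_diff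
        real_polynomial_function_pd *)
qed

lemma rational_off_zero_twice_diff: "rational_off_zero f \<Longrightarrow> twice_diff_off_zero f"
  by (simp add: twice_diff_off_zero_def rational_off_zero_differentiable rational_off_zero_pd)

section \<open>Restriction to a line as univariate polynomials\<close>

lemma real_polynomial_function_imp_poly:
  fixes f :: "real \<Rightarrow> real"
  assumes "real_polynomial_function f"
  obtains P where "f = poly P"
proof -
  obtain a n where "f = (\<lambda>x. \<Sum>i\<le>n. a i * x ^ i)"
    using real_polynomial_function_imp_sum[OF assms] by blast
  then have "f = poly (\<Sum>i\<le>n. monom (a i) i)"
    by (simp add: fun_eq_iff poly_sum poly_monom)
  then show thesis ..
qed

lemma real_polynomial_function_along_line:
  fixes f :: "real^'n::finite \<Rightarrow> real"
  assumes "real_polynomial_function f"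
  obtains P where "\<And>t. f (u + t *\<^sub>R v) = poly P t"
proof -
  have "polynomial_function (\<lambda>t::real. u + t *\<^sub>R v)"
    by (intro polynomial_function_add polynomial_function_const polynomial_function_mult
        polynomial_function_bounded_linear bounded_linear_ident)
  then have "real_polynomial_function (f \<circ> (\<lambda>t. u + t *\<^sub>R v))"
    using assms by (rule real_polynomial_function_compose)
  then obtain P where "f \<circ> (\<lambda>t. u + t *\<^sub>R v) = poly P"
    by (rule real_polynomial_function_imp_poly)
  then show thesis
    by (intro that[of P]) (metis comp_apply)
qed

lemma rational_off_zero_along_line:
  assumes "rational_off_zero f" "\<And>t. u + t *\<^sub>R v \<noteq> 0"
  obtains N D where "\<And>t. poly D t \<noteq> 0" "\<And>t. f (u + t *\<^sub>R v) = poly N t / poly D t"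
proof -
  obtain N D where *: "real_polynomial_function N" "real_polynomial_function D"
      and eq: "\<And>p. p \<noteq> 0 \<Longrightarrow> D p \<noteq> 0 \<and> f p = N p / D p"
    using assms unfolding rational_off_zero_def by metis
  obtain N' D' where "\<And>t. N (u + t *\<^sub>R v) = poly N' t" "\<And>t. D (u + t *\<^sub>R v) = poly D' t"
    using *[THEN real_polynomial_function_along_line, of u v] by metis
  then show thesis
    using that[of D' N'] eq[OF assms(2)] by simp
qed

text \<open>This is the integral closedness of \<open>\<real>[t]\<close>.\<close>

lemma rational_root_is_poly:
  fixes f :: "real \<Rightarrow> real"
  assumes "0 < k" and D: "\<And>t. poly D t \<noteq> 0" and f: "\<And>t. f t = poly N t / poly D t"
    and root: "\<And>t. f t ^ k = poly Q t" and deg: "degree Q \<le> k"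
  obtains R where "\<And>t. f t = poly R t" "degree R \<le> 1"
proof -
  have "N ^ k = D ^ k * Q"
  proof -
    have "poly N t ^ k = poly D t ^ k * poly Q t" for t
      using root[of t] f[of t] D[of t] by (simp add: power_divide field_simps)
    then have "poly (N ^ k) = poly (D ^ k * Q)"
      by (simp add: fun_eq_iff)
    then show ?thesis
      by (simp only: poly_eq_poly_eq_iff)
  qed
  then have "D ^ k dvd N ^ k"
    by simp
  \<comment> \<open>Factoriality of the ring of real polynomials removes the exponent.\<close>
  then have "D dvd N"
    using pow_divides_pow_iff[OF assms(1), of D N] by simp
  then obtain R where "N = D * R"
    by (rule dvdE)
  then have R: "f t = poly R t" for t
    using f D by simp
  have "R ^ k = Q"
    using root R by (metis poly_eq_poly_eq_iff poly_power ext)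
  then have "k * degree R \<le> k"
    using deg by (cases "R = 0") (auto simp: degree_power_eq)
  then show thesis
    using assms(1) by (intro that[OF R]) auto
qed

section \<open>Homogeneous forms\<close>

text \<open>With the coefficients of \<open>K\<close> and degree \<open>m\<close> this is the
  radicand; contracting fewer indices gives the entries of the matrix in the spray equation.\<close>

definition form :: "nat \<Rightarrow> ('n::finite list \<Rightarrow> real) \<Rightarrow> real^'n \<Rightarrow> real" where
  "form k \<beta> p = (\<Sum>I | length I = k. \<beta> I * mono_at p I)"

definition symmetric_coeffs :: "nat \<Rightarrow> ('n list \<Rightarrow> real) \<Rightarrow> bool" where
  "symmetric_coeffs k \<beta> \<longleftrightarrow> (\<forall>I J. length I = k \<and> mset I = mset J \<longrightarrow> \<beta> I = \<beta> J)"

lemma finite_multi_indices: "finite {I :: 'n::finite list. length I = k}"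
  using finite_lists_length_eq[of "UNIV :: 'n set" k] by simp

lemma form_0: "form 0 \<beta> p = \<beta> []"
  by (simp add: form_def mono_at_def)

text \<open>Splitting off the first index gives the recursion on which the inductions over the
  degree rest.\<close>

lemma form_Suc: "form (Suc k) \<beta> p = (\<Sum>i\<in>UNIV. p $ i * form k (\<lambda>I. \<beta> (i # I)) p)"
proof -
  have "{I :: 'a list. length I = Suc k} = (\<lambda>(i, I). i # I) ` (UNIV \<times> {I. length I = k})"
    by (auto simp: length_Suc_conv image_iff)
  then have "form (Suc k) \<beta> p = (\<Sum>(i, I)\<in>UNIV \<times> {I. length I = k}. \<beta> (i # I) * mono_at p (i # I))"
    unfolding form_def by (simp only:) (subst sum.reindex, auto simp: inj_on_def case_prod_beta)
  also have "\<dots> = (\<Sum>i\<in>UNIV. p $ i * form k (\<lambda>I. \<beta> (i # I)) p)"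
    by (simp add: form_def mono_at_def sum.cartesian_product[symmetric] sum_distrib_left mult.left_commute)
  finally show ?thesis .
qed

lemma form_cong: "(\<And>I. length I = k \<Longrightarrow> \<beta> I = \<gamma> I) \<Longrightarrow> form k \<beta> p = form k \<gamma> p"
  by (simp add: form_def)

lemma form_scale: "form k \<beta> (c *\<^sub>R p) = c ^ k * form k \<beta> p"
  by (induction k arbitrary: \<beta>) (simp_all add: form_0 form_Suc sum_distrib_left mult_ac)

lemma symmetric_coeffs_Cons:
  "symmetric_coeffs (Suc k) \<beta> \<Longrightarrow> symmetric_coeffs k (\<lambda>I. \<beta> (i # I))"
  by (simp add: symmetric_coeffs_def)

lemma symmetric_coeffs_swap:
  "symmetric_coeffs (Suc (Suc k)) \<beta> \<Longrightarrow> length I = k \<Longrightarrow> \<beta> (i # j # I) = \<beta> (j # i # I)"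
  by (simp add: symmetric_coeffs_def add_mset_commute)

text \<open>By symmetry each of the \<open>k + 1\<close> slots contributes the same term to the
  derivative.\<close>

lemma form_line_derivative:
  assumes "symmetric_coeffs (Suc k) \<beta>"
  shows "((\<lambda>s. form (Suc k) \<beta> (u + s *\<^sub>R v)) has_real_derivative
     (1 + real k) * (\<Sum>j\<in>UNIV. v $ j * form k (\<lambda>I. \<beta> (j # I)) (u + t *\<^sub>R v))) (at t)"
  using assms
proof (induction k arbitrary: \<beta>)
  case 0
  have "((\<lambda>s. \<Sum>i\<in>UNIV. (u $ i + s * v $ i) * \<beta> [i]) has_real_derivative
      (\<Sum>i\<in>UNIV. v $ i * \<beta> [i])) (at t)"
    by (auto intro!: derivative_eq_intros)
  then show ?case
    by (simp add: form_Suc form_0)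
next
  case (Suc k)
  let ?p = "u + t *\<^sub>R v"
  let ?T = "\<lambda>i j. form k (\<lambda>I. \<beta> (i # j # I)) ?p"
  have swap: "?T i j = ?T j i" for i j
    using symmetric_coeffs_swap[OF Suc.prems] by (intro form_cong) auto
  have "((\<lambda>s. \<Sum>i\<in>UNIV. (u $ i + s * v $ i) * form (Suc k) (\<lambda>I. \<beta> (i # I)) (u + s *\<^sub>R v))
      has_real_derivative
      (\<Sum>i\<in>UNIV. v $ i * form (Suc k) (\<lambda>I. \<beta> (i # I)) ?p +
        (1 + real k) * (\<Sum>j\<in>UNIV. v $ j * ?T i j) * (u $ i + t * v $ i))) (at t)"
    by (intro DERIV_sum DERIV_mult Suc.IH symmetric_coeffs_Cons[OF Suc.prems])
      (auto intro!: derivative_eq_intros)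
  \<comment> \<open>These are the terms where a later slot is differentiated. Symmetry moves that
    slot to the front, which makes them \<open>1 + real k\<close> copies of the term from the first
    slot.\<close>
  moreover have "(\<Sum>i\<in>UNIV. (1 + real k) * (\<Sum>j\<in>UNIV. v $ j * ?T i j) * (u $ i + t * v $ i)) =
      (1 + real k) * (\<Sum>i\<in>UNIV. \<Sum>j\<in>UNIV. v $ j * (?p $ i * ?T j i))"
    unfolding sum_distrib_left sum_distrib_right
    by (intro sum.cong refl) (simp add: swap mult_ac)
  moreover have "\<dots> = (1 + real k) * (\<Sum>j\<in>UNIV. v $ j * form (Suc k) (\<lambda>I. \<beta> (j # I)) ?p)"
    by (subst sum.swap) (simp add: form_Suc sum_distrib_left)
  ultimately show ?case
    by (simp add: form_Suc[of "Suc k"] sum.distrib algebra_simps)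
qed

lemma real_polynomial_function_mono_at: "real_polynomial_function (\<lambda>p. mono_at p I)"
proof (induction I)
  case (Cons i I)
  then have "real_polynomial_function (\<lambda>p. p $ i * mono_at p I)"
    using real_polynomial_function.intros(1)[OF bounded_linear_vec_nth]
    by (rule real_polynomial_function.intros(4)[rotated])
  then show ?case
    by (simp add: mono_at_def)
qed (simp add: mono_at_def real_polynomial_function.intros(2))

lemma real_polynomial_function_form: "real_polynomial_function (form k \<beta>)"
  unfolding form_def
  by (intro real_polynomial_function_sum finite_multi_indices real_polynomial_function.intros(4)
      real_polynomial_function_mono_at real_polynomial_function.intros(2))

text \<open>The degree bound is the point here; \<open>real_polynomial_function_along_line\<close>
  gives a polynomial without one.\<close>

lemma form_along_line:
  obtains P where "degree P \<le> k" "\<And>t. form k \<beta> (u + t *\<^sub>R v) = poly P t"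
proof -
  have "\<exists>P. degree P \<le> k \<and> (\<forall>t. form k \<beta> (u + t *\<^sub>R v) = poly P t)"
  proof (induction k arbitrary: \<beta>)
    case 0
    show ?case
      by (intro exI[of _ "[:\<beta> []:]"]) (simp add: form_0)
  next
    case (Suc k)
    have "\<exists>P. degree P \<le> k \<and> (\<forall>t. form k (\<lambda>I. \<beta> (i # I)) (u + t *\<^sub>R v) = poly P t)" for i
      by (rule Suc)
    then obtain P where P: "\<And>i. degree (P i) \<le> k"
        "\<And>i t. form k (\<lambda>I. \<beta> (i # I)) (u + t *\<^sub>R v) = poly (P i) t"
      by metis
    have "degree ([:u $ i, v $ i:] * P i) \<le> Suc k" for i
      using P(1)[of i] degree_mult_le[of "[:u $ i, v $ i:]" "P i"] by (simp split: if_splits)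
    then have "degree (\<Sum>i\<in>UNIV. [:u $ i, v $ i:] * P i) \<le> Suc k"
      by (intro degree_sum_le) auto
    moreover have "form (Suc k) \<beta> (u + t *\<^sub>R v) = poly (\<Sum>i\<in>UNIV. [:u $ i, v $ i:] * P i) t" for t
      by (simp add: form_Suc P poly_sum algebra_simps)
    ultimately show ?case
      by blast
  qed
  then show thesis
    using that by blast
qed

text \<open>The exponent \<open>2 * m\<close> treats all signs at once: for even \<open>m\<close>
  and negative \<open>y\<close>, \<open>root m y ^ m\<close> is \<open>- y\<close>.\<close>

lemma real_root_double_power:
  assumes "0 < m"
  shows "root m y ^ (2 * m) = y\<^sup>2"
proof -
  have "root m y ^ (2 * m) = (\<bar>root m y\<bar> ^ m)\<^sup>2"
    by (simp add: power_even_abs mult.commute[of m] flip: power_mult)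
  also have "\<bar>root m y\<bar> ^ m = \<bar>y\<bar>"
    using assms by (simp flip: real_root_abs)
  finally show ?thesis
    by simp
qed

lemma real_polynomial_function_det:
  fixes A :: "'b::real_normed_vector \<Rightarrow> real^'n^'n"
  assumes "\<And>i j. real_polynomial_function (\<lambda>p. A p $ i $ j)"
  shows "real_polynomial_function (\<lambda>p. det (A p))"
  unfolding det_def
  by (intro real_polynomial_function_sum real_polynomial_function.intros(4)
      real_polynomial_function_prod real_polynomial_function.intros(2) assms) auto

section \<open>The spray of a fixed cotangent space\<close>

text \<open>Only \<open>p\<close> varies in what follows, but \<open>\<alpha>\<close> remains a
  function on the chart because the Christoffel symbols differentiate it in
  \<open>x\<close>.\<close>

locale root_cartan_fibre =
  fixes m :: nat and F :: "real^'n::finite \<Rightarrow> real^'n \<Rightarrow> real"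
    and \<alpha> :: "real^'n \<Rightarrow> 'n list \<Rightarrow> real" and x :: "real^'n"
  assumes m: "3 \<le> m"
    and F_root: "F x p = root m (form m (\<alpha> x) p)"
    and sym: "symmetric_coeffs m (\<alpha> x)"
    and twice_diff: "twice_diff_off_zero (F x)"
    and posdef: "p \<noteq> 0 \<Longrightarrow> v \<noteq> 0 \<Longrightarrow>
      (\<Sum>i\<in>UNIV. \<Sum>j\<in>UNIV. fund_tensor F x p i j * v $ i * v $ j) > 0"
begin

section \<open>Homogeneity and positive definiteness on the fibre\<close>

lemma posdef_forms:
  assumes "u \<noteq> 0" "v \<noteq> 0"
  shows "(grad_form (F x) u v)\<^sup>2 + F x u * hess_form (F x) u v > 0"
  using posdef[OF assms] by (simp add: fund_tensor_form twice_diff assms)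

lemma F_power: "F x p ^ (2 * m) = (form m (\<alpha> x) p)\<^sup>2"
  using m by (simp add: F_root real_root_double_power)

text \<open>Euler's relations: on the ray through \<open>u\<close> the function is linear in
  \<open>s\<close> as long as \<open>1 + s\<close> is positive.\<close>

lemma radial:
  assumes "u \<noteq> 0"
  shows "grad_form (F x) u u = F x u" "hess_form (F x) u u = 0"
proof -
  have "F x (u + s *\<^sub>R u) = (1 + s) * F x u" if "-1 < s" for s
  proof -
    have "u + s *\<^sub>R u = (1 + s) *\<^sub>R u"
      by (simp add: scaleR_add_left)
    then show ?thesis
      using that m by (simp add: F_root form_scale real_root_mult real_root_power_cancel)
  qed
  moreover have "eventually (\<lambda>s::real. s \<in> {-1<..}) (nhds 0)"
    by (rule eventually_nhds_in_open) auto
  ultimately have ev: "eventually (\<lambda>s. F x (u + s *\<^sub>R u) = (1 + s) * F x u) (nhds 0)"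
    by (auto elim: eventually_mono)
  have "eventually (\<lambda>s. ((\<lambda>s. (1 + s) * F x u) has_real_derivative F x u) (at s)) (nhds 0)"
    by (auto intro!: derivative_eq_intros always_eventually)
  from line_derivatives_unique[OF twice_diff assms ev this, of 0]
  show "grad_form (F x) u u = F x u" "hess_form (F x) u u = 0"
    by auto
qed

text \<open>In the radial direction positive definiteness says that the square of
  \<open>F x u\<close> is positive.\<close>

lemma F_nonzero: "u \<noteq> 0 \<Longrightarrow> F x u \<noteq> 0"
  using posdef_forms[of u u] radial[of u] by auto

text \<open>This is \<open>a2\<close> freed of its factor \<open>inverse (F x p ^ (m - 2))\<close>,
  so that its entries are polynomials in \<open>p\<close>.\<close>

definition form_matrix :: "real^'n \<Rightarrow> real^'n^'n" where
  "form_matrix p = (\<chi> i j. form (m - 2) (\<lambda>I. \<alpha> x (i # j # I)) p)"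

text \<open>If \<open>form_matrix u *v v = 0\<close>, then the form has vanishing first and second derivatives at \<open>u\<close> in
  direction \<open>v\<close>, hence so does \<open>F\<close>, contradicting positive definiteness.\<close>

lemma form_matrix_kernel:
  assumes u: "u \<noteq> 0" and ker: "form_matrix u *v v = 0"
  shows "v = 0"
proof (rule ccontr)
  assume v: "v \<noteq> 0"
  define k where "k = m - 2"
  have k: "m = Suc (Suc k)"
    using m by (simp add: k_def)
  define Q0 where "Q0 = (\<lambda>s. form m (\<alpha> x) (u + s *\<^sub>R v))"
  define Q1 where "Q1 = (\<lambda>s. (2 + real k) *
    (\<Sum>i\<in>UNIV. v $ i * form (Suc k) (\<lambda>I. \<alpha> x (i # I)) (u + s *\<^sub>R v)))"
  define Q2 where "Q2 = (2 + real k) * (\<Sum>i\<in>UNIV. v $ i * ((1 + real k) *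
    (\<Sum>j\<in>UNIV. v $ j * form k (\<lambda>I. \<alpha> x (i # j # I)) u)))"
  have row: "(\<Sum>j\<in>UNIV. form k (\<lambda>I. \<alpha> x (i # j # I)) u * v $ j) = 0" for i
    using ker by (simp add: vec_eq_iff matrix_vector_mult_def form_matrix_def flip: k_def)
  have Q0': "(Q0 has_real_derivative Q1 s) (at s)" for s
    using form_line_derivative[of "Suc k" "\<alpha> x" u v s] sym
    by (simp add: Q0_def Q1_def k add.commute)
  have Q1': "(Q1 has_real_derivative Q2) (at 0)"
    unfolding Q1_def Q2_def
    by (intro DERIV_cmult DERIV_sum form_line_derivative[of k _ u v 0, simplified],
        rule symmetric_coeffs_Cons) (use sym k in simp)
  have "Q2 = 0"
    using row by (simp add: Q2_def mult.commute)
  \<comment> \<open>Splitting off one more \<open>u\<close> exhibits the first derivative as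
    \<open>m\<close> times the pairing of \<open>u\<close> with
    \<open>form_matrix u *v v\<close>.\<close>
  have "Q1 0 = (2 + real k) * (\<Sum>i\<in>UNIV. \<Sum>j\<in>UNIV. v $ i * (u $ j * form k (\<lambda>I. \<alpha> x (i # j # I)) u))"
    by (simp add: Q1_def form_Suc sum_distrib_left)
  also have "\<dots> = (2 + real k) * (\<Sum>j\<in>UNIV. u $ j * (\<Sum>i\<in>UNIV. form k (\<lambda>I. \<alpha> x (j # i # I)) u * v $ i))"
  proof -
    have "form k (\<lambda>I. \<alpha> x (i # j # I)) u = form k (\<lambda>I. \<alpha> x (j # i # I)) u" for i j
      using sym k by (intro form_cong symmetric_coeffs_swap) auto
    then show ?thesis
      by (subst sum.swap) (simp add: sum_distrib_left mult_ac)
  qed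
  finally have "Q1 0 = 0"
    by (simp add: row)
  define f0 where "f0 = (\<lambda>s. F x (u + s *\<^sub>R v))"
  define f1 where "f1 = (\<lambda>s. grad_form (F x) (u + s *\<^sub>R v) v)"
  have f0': "(f0 has_real_derivative f1 s) (at s)" if "u + s *\<^sub>R v \<noteq> 0" for s
    unfolding f0_def f1_def using twice_diff that by (rule line_derivatives(1))
  have f1': "(f1 has_real_derivative hess_form (F x) u v) (at 0)"
    unfolding f1_def using line_derivatives(2)[OF twice_diff, of u 0 v] u by simp
  have power: "f0 s ^ (2 * m) = (Q0 s)\<^sup>2" for s
    by (simp add: f0_def Q0_def F_power)
  have first: "2 * m * f0 s ^ (2 * m - 1) * f1 s = 2 * Q0 s * Q1 s" if "u + s *\<^sub>R v \<noteq> 0" for s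
  proof -
    have "((\<lambda>s. f0 s ^ (2 * m)) has_real_derivative 2 * m * f0 s ^ (2 * m - 1) * f1 s) (at s)"
      using f0'[OF that] by (auto intro!: derivative_eq_intros)
    moreover have "((\<lambda>s. (Q0 s)\<^sup>2) has_real_derivative 2 * Q0 s * Q1 s) (at s)"
      using Q0' by (auto intro!: derivative_eq_intros)
    ultimately show ?thesis
      unfolding power by (rule DERIV_unique)
  qed
  have f00: "f0 0 \<noteq> 0"
    using F_nonzero[OF u] by (simp add: f0_def)
  then have f10: "f1 0 = 0"
    using first[of 0] \<open>Q1 0 = 0\<close> u m by simp
  have ev: "eventually (\<lambda>s. 2 * m * f0 s ^ (2 * m - 1) * f1 s = 2 * Q0 s * Q1 s) (nhds 0)"
    using eventually_line_nonzero[OF u, of v] by eventually_elim (rule first)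
  \<comment> \<open>The identity for the first derivatives is differentiated once more. The right
    side gives 0, as \<open>Q1 0\<close> and \<open>Q2\<close> vanish; on the left
    \<open>f1 0 = 0\<close> leaves only the term with the Hessian.\<close>
  have "((\<lambda>s. 2 * Q0 s * Q1 s) has_real_derivative 0) (at 0)"
    using Q0'[of 0] Q1' \<open>Q2 = 0\<close> \<open>Q1 0 = 0\<close> by (auto intro!: derivative_eq_intros)
  then have "((\<lambda>s. 2 * m * f0 s ^ (2 * m - 1) * f1 s) has_real_derivative 0) (at 0)"
    by (subst DERIV_cong_ev[OF refl ev refl])
  moreover have "((\<lambda>s. 2 * m * f0 s ^ (2 * m - 1) * f1 s) has_real_derivative
      2 * m * f0 0 ^ (2 * m - 1) * hess_form (F x) u v) (at 0)"
    using f0'[of 0] f1' f10 u by (auto intro!: derivative_eq_intros)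
  ultimately have "0 = 2 * m * f0 0 ^ (2 * m - 1) * hess_form (F x) u v"
    by (rule DERIV_unique)
  then have "hess_form (F x) u v = 0"
    using f00 m by simp
  then show False
    using posdef_forms[OF u v] f10 by (simp add: f1_def)
qed

section \<open>Rationality of the spray coefficients\<close>

lemma det_form_matrix_nonzero:
  assumes "u \<noteq> 0"
  shows "det (form_matrix u) \<noteq> 0"
proof -
  have "\<forall>v. form_matrix u *v v = 0 \<longrightarrow> v = 0"
    using form_matrix_kernel[OF assms] by blast
  then show ?thesis
    by (simp only: invertible_det_nz[symmetric] invertible_left_inverse matrix_left_invertible_ker)
qed

text \<open>Both sides of the defining system carry the factor
  \<open>inverse (F x p ^ (m - 2))\<close>. Cancelling it leaves a system with matrix
  \<open>form_matrix p\<close>, whose unique solution Cramer's rule provides.\<close>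

lemma spray_eq:
  assumes "p \<noteq> 0"
  shows "spray m F \<alpha> x p $ r =
    det (\<chi> i j. if j = r then christoffel0 m \<alpha> x p i / m else form_matrix p $ i $ j) / det (form_matrix p)"
proof -
  have "(\<forall>h. (\<Sum>r\<in>UNIV. a2 m F \<alpha> x p h r * G $ r) =
      1 / (real m * F x p ^ (m - 2)) * christoffel0 m \<alpha> x p h) \<longleftrightarrow>
      form_matrix p *v G = (\<chi> i. christoffel0 m \<alpha> x p i / m)" for G
  proof -
    have "(\<Sum>r\<in>UNIV. a2 m F \<alpha> x p h r * G $ r) = inverse (F x p ^ (m - 2)) * (form_matrix p *v G) $ h" for h
      by (simp add: a2_def form_matrix_def form_def matrix_vector_mult_def sum_distrib_left mult_ac)
    moreover have "inverse (F x p ^ (m - 2)) * y = 1 / (real m * F x p ^ (m - 2)) * z \<longleftrightarrow> y = z / m"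
      for y z
      using F_nonzero[OF assms] m by (simp add: field_simps)
    ultimately show ?thesis
      by (simp only: vec_eq_iff vec_lambda_beta)
  qed
  then show ?thesis
    using cramer[OF det_form_matrix_nonzero[OF assms], of _ "\<chi> i. christoffel0 m \<alpha> x p i / m"]
    by (simp add: spray_def cong: if_cong)
qed

lemma spray_rational: "rational_off_zero (\<lambda>p. spray m F \<alpha> x p $ r)"
proof -
  have "real_polynomial_function (\<lambda>p. christoffel0 m \<alpha> x p h)" for h
    using real_polynomial_function_form[of m "\<lambda>I. gen_christoffel m \<alpha> x I h"]
    by (simp add: form_def[abs_def] christoffel0_def)
  then have "real_polynomial_function
      (\<lambda>p. if j = r then christoffel0 m \<alpha> x p i / m else form_matrix p $ i $ j)" for i j
    by (cases "j = r")
      (simp_all add: form_matrix_def real_polynomial_function_form real_polynomial_function_divide)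
  then have "real_polynomial_function
      (\<lambda>p. det (\<chi> i j. if j = r then christoffel0 m \<alpha> x p i / m else form_matrix p $ i $ j))"
    by (intro real_polynomial_function_det) simp
  moreover have "real_polynomial_function (\<lambda>p. det (form_matrix p))"
    by (intro real_polynomial_function_det) (simp add: form_matrix_def real_polynomial_function_form)
  ultimately show ?thesis
    unfolding rational_off_zero_def using spray_eq det_form_matrix_nonzero by blast
qed

section \<open>The mean Berwald curvature as a Hessian\<close>

definition spray_div :: "real^'n \<Rightarrow> real" where
  "spray_div p = (\<Sum>r\<in>UNIV. pd r (\<lambda>p. spray m F \<alpha> x p $ r) p)"

lemma spray_div_rational: "rational_off_zero spray_div"
  unfolding spray_div_def[abs_def]
  by (rule rational_off_zero_sum) (simp_all add: rational_off_zero_pd spray_rational)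

text \<open>In the trace the contracted index is also that of the innermost derivative, so it
  remains to move the sum inside the two outer ones.\<close>

lemma mean_berwald_eq_hessian:
  assumes "p \<noteq> 0"
  shows "mean_berwald m F \<alpha> x p i j = 1 / 2 * pd j (pd i spray_div) p"
proof -
  have rat: "rational_off_zero (pd r (\<lambda>p. spray m F \<alpha> x p $ r))" for r
    by (intro rational_off_zero_pd spray_rational)
  have "pd j (pd i spray_div) p = pd j (\<lambda>p. \<Sum>r\<in>UNIV. pd i (pd r (\<lambda>p. spray m F \<alpha> x p $ r)) p) p"
    using assms unfolding spray_div_def
    by (intro pd_cong[where V = "- {0}"]) (auto intro!: pd_sum rational_off_zero_differentiable rat)
  also have "\<dots> = (\<Sum>r\<in>UNIV. pd j (pd i (pd r (\<lambda>p. spray m F \<alpha> x p $ r))) p)"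
    using assms by (intro pd_sum) (auto intro!: rational_off_zero_differentiable rational_off_zero_pd rat)
  finally show ?thesis
    by (simp add: mean_berwald_def berwald_curvature_def)
qed

lemma hess_multiple_imp_zero:
  fixes u v :: "real^'n"
  assumes hess: "\<And>u v. u \<noteq> 0 \<Longrightarrow> hess_form spray_div u v = d * hess_form (F x) u v"
    and line: "\<And>t. u + t *\<^sub>R v \<noteq> 0" and v: "v \<noteq> 0"
  shows "d = 0"
proof (rule ccontr)
  assume d: "d \<noteq> 0"
  have S2: "twice_diff_off_zero spray_div"
    by (rule rational_off_zero_twice_diff[OF spray_div_rational])
  define e1 where "e1 = (\<lambda>t. grad_form spray_div (u + t *\<^sub>R v) v - d * grad_form (F x) (u + t *\<^sub>R v) v)"
  define e0 where "e0 = (\<lambda>t. spray_div (u + t *\<^sub>R v) - d * F x (u + t *\<^sub>R v))"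
  \<comment> \<open>\<open>e1\<close> is the derivative of \<open>e0\<close>, and
    \<open>hess\<close> makes the second derivative of \<open>e0\<close> vanish on the whole
    line.\<close>
  have "(e1 has_real_derivative 0) (at t)" for t
    unfolding e1_def
    using DERIV_diff[OF line_derivatives(2)[OF S2 line]
        DERIV_cmult[OF line_derivatives(2)[OF twice_diff line], of d]] hess[OF line] by simp
  then have e1: "e1 t = e1 0" for t
    by (rule DERIV_isconst_all[rule_format])
  have "(e0 has_real_derivative e1 t) (at t)" for t
    unfolding e0_def e1_def
    by (rule DERIV_diff[OF line_derivatives(1)[OF S2 line]
        DERIV_cmult[OF line_derivatives(1)[OF twice_diff line]]])
  then have "((\<lambda>t. e0 t - e1 0 * t) has_real_derivative 0) (at t)" for t
    by (auto intro!: derivative_eq_intros simp: e1[of t])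
  then have "e0 t - e1 0 * t = e0 0 - e1 0 * 0" for t
    by (rule DERIV_isconst_all[rule_format])
  then have affine: "d * F x (u + t *\<^sub>R v) = spray_div (u + t *\<^sub>R v) - (e0 0 + e1 0 * t)" for t
    by (simp add: e0_def algebra_simps)
  obtain D N where D: "\<And>t. poly D t \<noteq> 0" and N: "\<And>t. spray_div (u + t *\<^sub>R v) = poly N t / poly D t"
    by (rule rational_off_zero_along_line[OF spray_div_rational line], rule that)
  \<comment> \<open>Solving \<open>affine\<close> for \<open>F\<close> is where \<open>d\<close> has
    to be nonzero.\<close>
  have rat: "F x (u + t *\<^sub>R v) = poly (smult (1 / d) (N - [:e0 0, e1 0:] * D)) t / poly D t" for t
    using affine[of t] D[of t] d by (simp add: N field_simps)
  obtain P where P: "degree P \<le> m" "\<And>t. form m (\<alpha> x) (u + t *\<^sub>R v) = poly P t"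
    by (rule form_along_line, rule that)
  have "F x (u + t *\<^sub>R v) ^ (2 * m) = poly (P\<^sup>2) t" for t
    by (simp add: F_power P)
  moreover have "degree (P\<^sup>2) \<le> 2 * m"
    using P(1) degree_power_le[of P 2] by simp
  ultimately obtain R where R: "\<And>t. F x (u + t *\<^sub>R v) = poly R t" "degree R \<le> 1"
    using rational_root_is_poly[OF _ D rat, of "2 * m"] m by force
  obtain a R' where "R = pCons a R'" "degree R' = 0"
    using R(2) by (cases R) (auto split: if_splits)
  then obtain b where ab: "R = [:a, b:]"
    by (metis degree_eq_zeroE)
  \<comment> \<open>Otherwise the linear polynomial has a real zero, at a point of the line where
    \<open>F\<close> cannot vanish.\<close>
  have "b = 0"
  proof (rule ccontr)
    assume "b \<noteq> 0"
    then have "F x (u + (- a / b) *\<^sub>R v) = 0"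
      using R(1)[of "- a / b"] by (simp add: ab)
    then show False
      using F_nonzero line by blast
  qed
  then have "eventually (\<lambda>s. F x (u + s *\<^sub>R v) = a) (nhds 0)"
    by (simp add: R ab)
  moreover have u: "u \<noteq> 0"
    using line[of 0] by simp
  ultimately have "grad_form (F x) u v = 0" "hess_form (F x) u v = 0"
    using line_derivatives_unique[OF twice_diff, of u v "\<lambda>_. a" "\<lambda>_. 0" 0] by auto
  then show False
    using posdef_forms[OF u v] by simp
qed

lemma isotropic_imp_mean_berwald_zero:
  assumes iso: "\<And>p i j. p \<noteq> 0 \<Longrightarrow> mean_berwald m F \<alpha> x p i j =
      (real CARD('n) + 1) / 2 * c * inverse (F x p) * angular_metric F x p i j"
    and p: "p \<noteq> 0"
  shows "mean_berwald m F \<alpha> x p i j = 0"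
proof -
  define d where "d = (real CARD('n) + 1) * c"
  have SF: "pd j (pd i spray_div) p = d * pd i (pd j (F x)) p" if "p \<noteq> 0" for p i j
    using iso[OF that, of i j] mean_berwald_eq_hessian[OF that, of i j] F_nonzero[OF that]
    by (simp add: angular_metric_def d_def field_simps)
  show ?thesis
  proof (cases "CARD('n) = 1")
    case True
    then obtain k :: 'n where "UNIV = {k}"
      by (rule card_1_singletonE)
    then have all_eq: "l = i" for l
      by (metis UNIV_I singletonD)
    then have univ: "UNIV = {i}" "j = i"
      by auto
    have "p $ i \<noteq> 0"
      using p all_eq by (metis vec_eq_iff zero_index)
    \<comment> \<open>In dimension one the radial Hessian is this second derivative times the square
      of \<open>p $ i\<close>.\<close>
    then have "pd i (pd i (F x)) p = 0"
      using radial(2)[OF p] by (simp add: hess_form_def univ(1))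
    then show ?thesis
      by (simp add: iso[OF p] angular_metric_def univ(2))
  next
    case False
    have "\<exists>k l :: 'n. k \<noteq> l"
    proof (rule ccontr)
      assume "\<nexists>k l :: 'n. k \<noteq> l"
      then have "UNIV = {i}"
        by auto
      then have "CARD('n) = card {i}"
        by (simp only:)
      then show False
        using False by simp
    qed
    then obtain k l :: 'n where "k \<noteq> l"
      by blast
    \<comment> \<open>In \<open>SF\<close> the order of the two partial derivatives differs between
      the sides; inserting \<open>v\<close> into both slots and exchanging the sums makes up for
      it.\<close>
    have "hess_form spray_div u v = d * hess_form (F x) u v" if "u \<noteq> 0" for u v
    proof -
      have "hess_form spray_div u v = (\<Sum>j\<in>UNIV. \<Sum>i\<in>UNIV. v $ j * (v $ i * (d * pd j (pd i (F x)) u)))"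
        by (simp add: hess_form_def SF[OF that] sum_distrib_left)
      also have "\<dots> = d * hess_form (F x) u v"
        unfolding hess_form_def sum_distrib_left
        by (subst sum.swap) (simp add: mult_ac)
      finally show ?thesis .
    qed
    \<comment> \<open>The line misses the origin because its \<open>k\<close>-th coordinate is
      constantly 1.\<close>
    moreover have "axis k 1 + t *\<^sub>R axis l 1 \<noteq> (0 :: real^'n)" for t
      using \<open>k \<noteq> l\<close> by (auto simp: vec_eq_iff axis_def intro!: exI[of _ k])
    ultimately have "d = 0"
      by (rule hess_multiple_imp_zero) (simp_all add: axis_eq_0_iff)
    then show ?thesis
      by (simp add: iso[OF p] d_def)
  qed
qed

end

section \<open>From single fibres to the manifold\<close>

theorem theorem1p3:
  fixes M :: "'a topology"
    and A :: "('a, 'n::finite) chart set"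
    and K :: "'a \<times> (('a, 'n) chart \<Rightarrow> real^'n) \<Rightarrow> real"
    and m :: nat
    and a :: "('a, 'n) chart \<Rightarrow> real^'n \<Rightarrow> 'n list \<Rightarrow> real"
  assumes "smooth_manifold M A"
    and "3 \<le> m"
    and "mth_root_cartan_space M A K m a"
    and "isotropic_mean_berwald A K m a"
  shows "weakly_berwald A K m a"
proof -
  obtain c where c: "\<And>\<phi> q p i j. \<phi> \<in> A \<Longrightarrow> q \<in> fst \<phi> \<Longrightarrow> p \<noteq> 0 \<Longrightarrow>
      mean_berwald m (local_rep A K \<phi>) (a \<phi>) (snd \<phi> q) p i j =
        (real CARD('n) + 1) / 2 * c q * inverse (local_rep A K \<phi> (snd \<phi> q) p) *
        angular_metric (local_rep A K \<phi>) (snd \<phi> q) p i j"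
    using assms(4) unfolding isotropic_mean_berwald_def by metis
  have "mean_berwald m (local_rep A K \<phi>) (a \<phi>) (snd \<phi> q) p i j = 0"
    if \<phi>: "\<phi> \<in> A" and q: "q \<in> fst \<phi>" and p: "p \<noteq> 0" for \<phi> q p i j
  proof -
    have x: "snd \<phi> q \<in> chart_image \<phi>"
      using q by (simp add: chart_image_def)
    have "open (chart_image \<phi>)"
      using assms(1) \<phi> by (simp add: smooth_manifold_def)
    moreover have cartan: "cartan_space M A K"
      using assms(3) by (simp add: mth_root_cartan_space_def)
    then have "smooth_on (chart_image \<phi> \<times> (UNIV - {0})) (\<lambda>(x, p). local_rep A K \<phi> x p)"
      using \<phi> by (simp add: cartan_space_def)
    ultimately have twice: "twice_diff_off_zero (local_rep A K \<phi> (snd \<phi> q))"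
      using smooth_on_slice[OF _ x] by force
    have root: "local_rep A K \<phi> (snd \<phi> q) p = root m (form m (a \<phi> (snd \<phi> q)) p)" for p
      using assms(3) \<phi> x unfolding mth_root_cartan_space_def form_def by blast
    have sym: "symmetric_coeffs m (a \<phi> (snd \<phi> q))"
      using assms(3) \<phi> x unfolding mth_root_cartan_space_def symmetric_coeffs_def by blast
    have posdef: "(\<Sum>i\<in>UNIV. \<Sum>j\<in>UNIV.
        fund_tensor (local_rep A K \<phi>) (snd \<phi> q) p i j * v $ i * v $ j) > 0"
      if "p \<noteq> 0" "v \<noteq> 0" for p v
      using cartan \<phi> x that unfolding cartan_space_def by blast
    interpret root_cartan_fibre m "local_rep A K \<phi>" "a \<phi>" "snd \<phi> q"
      using assms(2) root sym twice posdef by (rule root_cartan_fibre.intro)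
    show ?thesis
      \<comment> \<open>On the fibre over \<open>q\<close> the scalar \<open>c q\<close> is a
        constant.\<close>
      using c[OF \<phi> q] p by (rule isotropic_imp_mean_berwald_zero)
  qed
  then show ?thesis
    unfolding weakly_berwald_def by blast
qed

end
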